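(* Let $A\in\mathcal E$ be a measurable set with $\mu(A)=1$, let $N_A=\eta(A)$ (a Poisson random variable with mean $1$), and set $$U:=I_1^\eta(\mathbf 1_A)=N_A-1,\qquad V:=I_2^\eta(\mathbf 1_A^{\otimes 2})=(N_A-1)^2-N_A.$$ For $\alpha\in\mathbb R$ define $$S_\alpha:=\frac{1}{\sqrt{1+2\alpha^2}}\,(U+\alpha V).$$ Then there exists $\alpha_*\in\mathbb R$ such that $$E[S_{\alpha_*}^2]=1,\qquad E[S_{\alpha_*}^4]=3,$$ while $S_{\alpha_*}$ is not Gaussian; in fact $E[S_{\alpha_*}^3]\neq 0$.
   Context: $\eta$ is a Poisson random measure on a measurable space $(E,\mathcal E)$ with $\sigma$-finite control (intensity) measure $\mu$, and $\hat\eta=\eta-\mu$. For $f\in L^2(\mu^m)$ symmetric, $I_m^\eta(f)$ denotes the $m$-th multiple Wiener--Itô (Poisson) integral of $f$ with respect to $\hat\eta$ (diagonals excluded). For the kernels used in the claim these integrals are the explicit polynomials in $N_A$ displayed there, so the claim concerns only a Poisson random variable $N_A$ with mean $1$. *)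

theory Defs
  imports "HOL-Probability.Probability"
begin

text \<open>
  A Poisson random measure \<open>\<eta>\<close> with control measure \<open>\<mu>\<close>.  The law is split into two cases
  because the library's \<open>poisson_pmf\<close> needs a positive rate.  That \<open>\<eta>(B) = \<infinity>\<close> almost surely
  when \<open>\<mu>(B) = \<infinity>\<close> follows from sigma-finiteness and independence.
\<close>

locale poisson_random_measure = prob_space M + control: sigma_finite_measure \<mu>
  for M :: "'w measure" and \<mu> :: "'e measure" +
  fixes \<eta> :: "'w \<Rightarrow> 'e measure"
  assumes sets_eta: "\<And>\<omega>. \<omega> \<in> space M \<Longrightarrow> sets (\<eta> \<omega>) = sets \<mu>"
    and measurable_eta:
      "\<And>B. B \<in> sets \<mu> \<Longrightarrow> (\<lambda>\<omega>. emeasure (\<eta> \<omega>) B) \<in> borel_measurable M"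
    and law_pos:
      "\<And>B. B \<in> sets \<mu> \<Longrightarrow> 0 < emeasure \<mu> B \<Longrightarrow> emeasure \<mu> B < \<infinity> \<Longrightarrow>
         distr M borel (\<lambda>\<omega>. emeasure (\<eta> \<omega>) B) =
         distr (measure_pmf (poisson_pmf (measure \<mu> B))) borel (of_nat :: nat \<Rightarrow> ennreal)"
    and law_null:
      "\<And>B. B \<in> sets \<mu> \<Longrightarrow> emeasure \<mu> B = 0 \<Longrightarrow> AE \<omega> in M. emeasure (\<eta> \<omega>) B = 0"
    and independent:
      "\<And>(B :: nat \<Rightarrow> 'e set) I. finite I \<Longrightarrow> B ` I \<subseteq> sets \<mu> \<Longrightarrow> disjoint_family_on B I \<Longrightarrow>
         indep_vars (\<lambda>_. borel) (\<lambda>i \<omega>. emeasure (\<eta> \<omega>) (B i)) I"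

text \<open>
  A kernel of \<open>m\<close> variables is a function on \<open>space (\<Pi>\<^sub>M i\<in>{..<m}. \<mu>)\<close>, so the tuple
  \<open>(x\<^sub>0, \<dots>, x\<^sub>m\<^sub>-\<^sub>1)\<close> is an extensional function on \<open>{..<m}\<close>.
\<close>

definition symmetric_kernel :: "'e measure \<Rightarrow> nat \<Rightarrow> ((nat \<Rightarrow> 'e) \<Rightarrow> real) \<Rightarrow> bool" where
  "symmetric_kernel \<mu> m f \<longleftrightarrow>
     (\<forall>\<pi>. \<pi> permutes {..<m} \<longrightarrow>
        (\<forall>x \<in> space (Pi\<^sub>M {..<m} (\<lambda>_. \<mu>)). f (x \<circ> \<pi>) = f x))"

definition square_integrable_kernel ::
    "'e measure \<Rightarrow> nat \<Rightarrow> ((nat \<Rightarrow> 'e) \<Rightarrow> real) \<Rightarrow> bool" where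
  "square_integrable_kernel \<mu> m f \<longleftrightarrow>
     f \<in> borel_measurable (Pi\<^sub>M {..<m} (\<lambda>_. \<mu>)) \<and>
     integrable (Pi\<^sub>M {..<m} (\<lambda>_. \<mu>)) (\<lambda>x. (f x)\<^sup>2)"

definition tensor_power :: "nat \<Rightarrow> ('e \<Rightarrow> real) \<Rightarrow> (nat \<Rightarrow> 'e) \<Rightarrow> real" where
  "tensor_power m g x = (\<Prod>i<m. g (x i))"

text \<open>
  Integral against the \<open>m\<close>-th factorial measure \<open>\<nu>\<^sup>(\<^sup>m\<^sup>)\<close> of a counting measure \<open>\<nu>\<close>.  For
  \<open>\<nu> = \<Sum>\<^sub>i \<delta>(y\<^sub>i)\<close> it is the sum of \<open>f (y\<^sub>i\<^sub>0, y\<^sub>i\<^sub>1, \<dots>)\<close> over tuples of pairwise distinct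
  indices.  The recursion integrates out the last variable and removes the diagonal terms; unlike
  restricting \<open>\<nu>\<^sup>m\<close> to pairwise distinct points, it is also correct when \<open>\<nu>\<close> has multiple points,
  that is, when \<open>\<mu>\<close> has atoms.
\<close>

primrec factorial_integral :: "'e measure \<Rightarrow> nat \<Rightarrow> ((nat \<Rightarrow> 'e) \<Rightarrow> real) \<Rightarrow> real" where
  "factorial_integral \<nu> 0 f = f (\<lambda>_. undefined)"
| "factorial_integral \<nu> (Suc m) f =
     factorial_integral \<nu> m
       (\<lambda>x. (\<integral>y. f (x(m := y)) \<partial>\<nu>) - (\<Sum>j<m. f (x(m := x j))))"

text \<open>
  The off-diagonal integral of a symmetric \<open>\<mu>\<^sup>m\<close>-integrable kernel against the \<open>m\<close>-th power of
  \<open>\<nu> - \<mu>\<close>, expanded binomially with \<open>\<nu>\<^sup>k\<close> replaced by \<open>\<nu>\<^sup>(\<^sup>k\<^sup>)\<close>: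
  \<open>\<Sum>\<^sub>k (-1)\<^sup>m\<^sup>-\<^sup>k (m choose k) \<integral>\<integral> f d\<nu>\<^sup>(\<^sup>k\<^sup>) d\<mu>\<^sup>m\<^sup>-\<^sup>k\<close>.
\<close>

definition compensated_integral ::
    "'e measure \<Rightarrow> 'e measure \<Rightarrow> nat \<Rightarrow> ((nat \<Rightarrow> 'e) \<Rightarrow> real) \<Rightarrow> real" where
  "compensated_integral \<mu> \<nu> m f =
     (\<Sum>k\<le>m. (-1) ^ (m - k) * real (m choose k) *
        factorial_integral \<nu> k
          (\<lambda>x. \<integral>y. f (merge {..<k} {k..<m} (x, y)) \<partial>(Pi\<^sub>M {k..<m} (\<lambda>_. \<mu>))))"

text \<open>
  The multiple Wiener--Ito integral \<open>I\<^sub>m(f)\<close> of a symmetric \<open>f \<in> L\<^sup>2(\<mu>\<^sup>m)\<close>: given pathwise by the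
  compensated integral if \<open>f\<close> is also in \<open>L\<^sup>1(\<mu>\<^sup>m)\<close>, and otherwise, by the isometry property, any
  version of the \<open>L\<^sup>2\<close>-limit along symmetric kernels in \<open>L\<^sup>1 \<inter> L\<^sup>2\<close> that approximate \<open>f\<close>.
  It is meaningful up to almost sure equality.
\<close>

definition wiener_ito ::
    "'w measure \<Rightarrow> 'e measure \<Rightarrow> ('w \<Rightarrow> 'e measure) \<Rightarrow> nat \<Rightarrow> ((nat \<Rightarrow> 'e) \<Rightarrow> real) \<Rightarrow> 'w \<Rightarrow> real"
  where
  "wiener_ito M \<mu> \<eta> m f =
     (if integrable (Pi\<^sub>M {..<m} (\<lambda>_. \<mu>)) f
      then (\<lambda>\<omega>. compensated_integral \<mu> (\<eta> \<omega>) m f)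
      else (SOME X. X \<in> borel_measurable M \<and> integrable M (\<lambda>\<omega>. (X \<omega>)\<^sup>2) \<and>
        (\<exists>g. (\<forall>n. symmetric_kernel \<mu> m (g n) \<and> square_integrable_kernel \<mu> m (g n) \<and>
                  integrable (Pi\<^sub>M {..<m} (\<lambda>_. \<mu>)) (g n) \<and>
                  integrable M (\<lambda>\<omega>. (compensated_integral \<mu> (\<eta> \<omega>) m (g n) - X \<omega>)\<^sup>2)) \<and>
             (\<lambda>n. \<integral>x. (g n x - f x)\<^sup>2 \<partial>(Pi\<^sub>M {..<m} (\<lambda>_. \<mu>))) \<longlonglongrightarrow> 0 \<and>
             (\<lambda>n. \<integral>\<omega>. (compensated_integral \<mu> (\<eta> \<omega>) m (g n) - X \<omega>)\<^sup>2 \<partial>M) \<longlonglongrightarrow> 0)))"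

text \<open>Almost surely constant variables count as (degenerate) Gaussian variables.\<close>

definition gaussian :: "'w measure \<Rightarrow> ('w \<Rightarrow> real) \<Rightarrow> bool" where
  "gaussian M X \<longleftrightarrow>
     (\<exists>c \<sigma>. 0 < \<sigma> \<and> distributed M lborel X (\<lambda>x. ennreal (normal_density c \<sigma> x))) \<or>
     (X \<in> borel_measurable M \<and> (\<exists>c. AE \<omega> in M. X \<omega> = c))"

end

theory Submission
  imports Defs
begin

text \<open>
  The Stein identity \<open>E[N g(N)] = r E[g(N + 1)]\<close> of a Poisson variable turns into a recursion for
  its central moments, so every moment of \<open>S\<^sub>\<alpha>\<close>, a polynomial in \<open>N\<close>, is explicit.  The condition
  \<open>E[S\<^sub>\<alpha>\<^sup>4] = 3\<close> becomes \<open>200 \<alpha>\<^sup>4 + 224 \<alpha>\<^sup>3 + 96 \<alpha>\<^sup>2 + 24 \<alpha> + 1 = 0\<close>, which changes sign between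
  \<open>-1/10\<close> and \<open>0\<close>; there \<open>E[S\<^sub>\<alpha>\<^sup>3]\<close> is a positive multiple of
  \<open>1 + 6 \<alpha> + 12 \<alpha>\<^sup>2 + 12 \<alpha>\<^sup>3 > 0\<close>.  The law of \<open>S\<^sub>\<alpha>\<close> has an atom, the value on \<open>N = 0\<close>, which
  excludes a Gaussian density, and \<open>E[S\<^sub>\<alpha>\<^sup>4] \<noteq> E[S\<^sub>\<alpha>\<^sup>2]\<^sup>2\<close> excludes a constant.
\<close>

section \<open>Moments of the Poisson law\<close>

lemma poisson_pmf_Stein:
  fixes g :: "nat \<Rightarrow> real"
  assumes "0 < r"
  shows "integrable (poisson_pmf r) (\<lambda>n. real n * g n) \<longleftrightarrow>
           integrable (poisson_pmf r) (\<lambda>n. g (Suc n))" (is ?int)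
    and "integrable (poisson_pmf r) (\<lambda>n. g (Suc n)) \<Longrightarrow>
           (\<integral>n. real n * g n \<partial>poisson_pmf r) = r * (\<integral>n. g (Suc n) \<partial>poisson_pmf r)"
proof -
  let ?p = "pmf (poisson_pmf r)"
  have int_iff: "integrable (poisson_pmf r) f \<longleftrightarrow> summable (\<lambda>n. norm (?p n * f n))"
    for f :: "nat \<Rightarrow> real"
    unfolding measure_pmf_eq_density
    by (subst integrable_density) (auto simp: integrable_count_space_nat_iff)
  have int_eq: "(\<integral>n. f n \<partial>poisson_pmf r) = (\<Sum>n. ?p n * f n)"
    if "integrable (poisson_pmf r) f" for f :: "nat \<Rightarrow> real"
  proof -
    have "(\<integral>n. f n \<partial>poisson_pmf r) = (\<integral>n. ?p n * f n \<partial>count_space UNIV)"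
      unfolding measure_pmf_eq_density by (subst integral_density) auto
    also have "\<dots> = (\<Sum>n. ?p n * f n)"
      using that
      by (intro integral_count_space_nat) (auto simp: int_iff integrable_count_space_nat_iff)
    finally show ?thesis .
  qed
  \<comment> \<open>Poisson weights satisfy (n + 1) p(n + 1) = r p(n). The term n = 0 of the series
    for n g(n) vanishes, so both claims follow by shifting the index.\<close>
  have shift: "?p (Suc n) * (real (Suc n) * g (Suc n)) = r * (?p n * g (Suc n))" for n
    using assms by (simp add: field_simps del: of_nat_Suc)
  show iff: ?int
  proof -
    have "integrable (poisson_pmf r) (\<lambda>n. real n * g n) \<longleftrightarrow>
        summable (\<lambda>n. norm (?p (Suc n) * (real (Suc n) * g (Suc n))))"
      unfolding int_iff by (subst summable_Suc_iff) simp
    also have "\<dots> \<longleftrightarrow> summable (\<lambda>n. \<bar>r\<bar> * norm (?p n * g (Suc n)))"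
      unfolding shift by (simp add: abs_mult)
    also have "\<dots> \<longleftrightarrow> integrable (poisson_pmf r) (\<lambda>n. g (Suc n))"
      unfolding int_iff using assms by (subst summable_cmult_iff) simp
    finally show ?thesis .
  qed
  show "(\<integral>n. real n * g n \<partial>poisson_pmf r) = r * (\<integral>n. g (Suc n) \<partial>poisson_pmf r)"
    if int: "integrable (poisson_pmf r) (\<lambda>n. g (Suc n))"
  proof -
    have int': "integrable (poisson_pmf r) (\<lambda>n. real n * g n)"
      using int iff by simp
    have sum: "summable (\<lambda>n. ?p n * (real n * g n))"
      using int' unfolding int_iff by (rule summable_norm_cancel)
    have sum': "summable (\<lambda>n. ?p n * g (Suc n))"
      using int unfolding int_iff by (rule summable_norm_cancel)
    have "(\<Sum>n. ?p n * (real n * g n)) = (\<Sum>n. ?p (Suc n) * (real (Suc n) * g (Suc n)))"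
      using suminf_split_head[OF sum] by simp
    also have "\<dots> = r * (\<Sum>n. ?p n * g (Suc n))"
      unfolding shift using sum' by (rule suminf_mult)
    finally show ?thesis
      using int int' by (simp add: int_eq)
  qed
qed

text \<open>By the Stein equivalence, n^(l + 1) is integrable as soon as (n + 1)^l is, and the
  latter expands into powers of n of degree at most l; hence the strong induction.\<close>

lemma integrable_poisson_pmf_power:
  assumes "0 < r"
  shows "integrable (poisson_pmf r) (\<lambda>n. (real n + c) ^ k)"
proof -
  have pow: "integrable (poisson_pmf r) (\<lambda>n. real n ^ k)" for k
  proof (induction k rule: less_induct)
    case (less k)
    show ?case
    proof (cases k)
      case (Suc l)
      have "integrable (poisson_pmf r) (\<lambda>n. \<Sum>j\<le>l. of_nat (l choose j) * real n ^ j * 1 ^ (l - j))"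
        using less Suc
        by (intro Bochner_Integration.integrable_sum integrable_mult_left integrable_mult_right) auto
      then have "integrable (poisson_pmf r) (\<lambda>n. real (Suc n) ^ l)"
        using binomial_ring[of "real _" 1 l] by (simp add: add.commute)
      then show ?thesis
        unfolding Suc power_Suc by (subst poisson_pmf_Stein(1)[OF assms])
    qed simp
  qed
  show ?thesis
    unfolding binomial_ring
    by (intro Bochner_Integration.integrable_sum integrable_mult_left integrable_mult_right pow)
qed

text \<open>Split off one factor n - r. Stein's identity turns the part with n into r
  E[(N + 1 - r)^k]; in its binomial expansion the top term j = k cancels against the part with r,
  which leaves j < k.\<close>

lemma poisson_pmf_central_moment_Suc:
  assumes "0 < r"
  shows "(\<integral>n. (real n - r) ^ Suc k \<partial>poisson_pmf r) =
           r * (\<Sum>j<k. real (k choose j) * (\<integral>n. (real n - r) ^ j \<partial>poisson_pmf r))"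
proof -
  have int: "integrable (poisson_pmf r) (\<lambda>n. (real n - r) ^ j)" for j
    using integrable_poisson_pmf_power[OF assms, of "-r" j] by simp
  have shift: "(real (Suc n) - r) ^ k = (\<Sum>j\<le>k. real (k choose j) * (real n - r) ^ j)" for n
    using binomial_ring[of "real n - r" 1 k] by (simp add: algebra_simps)
  have int_shift: "integrable (poisson_pmf r) (\<lambda>n. (real (Suc n) - r) ^ k)"
    unfolding shift by (intro Bochner_Integration.integrable_sum integrable_mult_right int)
  then have int_Stein: "integrable (poisson_pmf r) (\<lambda>n. real n * (real n - r) ^ k)"
    by (subst poisson_pmf_Stein(1)[OF assms])
  have "(\<integral>n. (real n - r) ^ Suc k \<partial>poisson_pmf r) =
      (\<integral>n. real n * (real n - r) ^ k - r * (real n - r) ^ k \<partial>poisson_pmf r)"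
    by (simp add: left_diff_distrib)
  also have "\<dots> = (\<integral>n. real n * (real n - r) ^ k \<partial>poisson_pmf r) -
      r * (\<integral>n. (real n - r) ^ k \<partial>poisson_pmf r)"
    using int_Stein int by simp
  also have "(\<integral>n. real n * (real n - r) ^ k \<partial>poisson_pmf r) =
      r * (\<integral>n. (real (Suc n) - r) ^ k \<partial>poisson_pmf r)"
    by (rule poisson_pmf_Stein(2)[OF assms int_shift])
  also have "(\<integral>n. (real (Suc n) - r) ^ k \<partial>poisson_pmf r) =
      (\<Sum>j\<le>k. real (k choose j) * (\<integral>n. (real n - r) ^ j \<partial>poisson_pmf r))"
    unfolding shift using int by simp
  finally show ?thesis
    by (simp add: lessThan_Suc_atMost[symmetric] algebra_simps)
qed

text \<open>Order 8 is required because a fourth power of a quadratic polynomial in N - 1 has to be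
  integrated.\<close>

lemma poisson_pmf_1_central_moments:
  defines "m \<equiv> \<lambda>k. \<integral>n. (real n - 1) ^ k \<partial>poisson_pmf 1"
  shows "m 0 = 1" "m 1 = 0" "m 2 = 1" "m 3 = 1" "m 4 = 4" "m 5 = 11" "m 6 = 41" "m 7 = 162"
    "m 8 = 715"
proof -
  have rec: "m (Suc k) = (\<Sum>j<k. real (k choose j) * m j)" for k
    unfolding m_def using poisson_pmf_central_moment_Suc[of 1 k] by simp
  show m0: "m 0 = 1"
    by (simp add: m_def)
  show m1: "m 1 = 0"
    using rec[of 0] by simp
  show m2: "m 2 = 1"
    using rec[of 1] m0 by (simp add: numeral_2_eq_2)
  show m3: "m 3 = 1"
    using rec[of 2] m0 m1 by (simp add: eval_nat_numeral)
  show m4: "m 4 = 4"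
    using rec[of 3] m0 m1 m2 by (simp add: eval_nat_numeral)
  show m5: "m 5 = 11"
    using rec[of 4] m0 m1 m2 m3 by (simp add: eval_nat_numeral)
  show m6: "m 6 = 41"
    using rec[of 5] m0 m1 m2 m3 m4 by (simp add: eval_nat_numeral)
  show m7: "m 7 = 162"
    using rec[of 6] m0 m1 m2 m3 m4 m5 by (simp add: eval_nat_numeral)
  show "m 8 = 715"
    using rec[of 7] m0 m1 m2 m3 m4 m5 m6 by (simp add: eval_nat_numeral)
qed

lemma poisson_pmf_1_chaos_moments:
  fixes a :: real
  defines "S \<equiv> \<lambda>n. (real n - 1) + a * ((real n - 1)\<^sup>2 - real n)"
  shows "(\<integral>n. S n ^ 2 \<partial>poisson_pmf 1) = 1 + 2 * a ^ 2"
    and "(\<integral>n. S n ^ 3 \<partial>poisson_pmf 1) = 1 + 6 * a + 12 * a ^ 2 + 12 * a ^ 3"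
    and "(\<integral>n. S n ^ 4 \<partial>poisson_pmf 1) =
           4 + 24 * a + 108 * a ^ 2 + 224 * a ^ 3 + 212 * a ^ 4"
proof -
  \<comment> \<open>With u = n - 1 one has (n - 1)^2 - n = u^2 - u - 1, so the linear coefficient of
    S is 1 - a.\<close>
  define b where "b = 1 - a"
  have int: "integrable (poisson_pmf 1) (\<lambda>n. c * (real n - 1) ^ j)" for c :: real and j
    using integrable_poisson_pmf_power[of 1 "-1" j] by simp
  have expand: "(\<integral>n. q (real n - 1) \<partial>poisson_pmf 1) =
      (\<Sum>j\<le>d. c j * (\<integral>n. (real n - 1) ^ j \<partial>poisson_pmf 1))"
    if "\<And>u. q u = (\<Sum>j\<le>d. c j * u ^ j)" for q c :: "_ \<Rightarrow> real" and d
    unfolding that using int by simp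
  note moments = poisson_pmf_1_central_moments
  text \<open>
    With \<open>u = n - 1\<close>, \<open>S n = a u\<^sup>2 + b u - a\<close>; these are the coefficients of its powers in \<open>u\<close>.
  \<close>
  define c2 where "c2 = (!) [a^2, -2*a*b, b^2 - 2*a^2, 2*a*b, a^2]"
  define c3 where "c3 = (!) [-(a^3), 3*a^2*b, 3*a^3 - 3*a*b^2, b^3 - 6*a^2*b, 3*a*b^2 - 3*a^3,
    3*a^2*b, a^3]"
  define c4 where "c4 = (!) [a^4, -4*a^3*b, 6*a^2*b^2 - 4*a^4, 12*a^3*b - 4*a*b^3,
    b^4 - 12*a^2*b^2 + 6*a^4, 4*a*b^3 - 12*a^3*b, 6*a^2*b^2 - 4*a^4, 4*a^3*b, a^4]"
  have S: "S n = (\<lambda>u. a * u^2 + b * u - a) (real n - 1)" for n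
    by (simp add: S_def b_def algebra_simps)
  have "(\<integral>n. S n ^ 2 \<partial>poisson_pmf 1) =
      (\<Sum>j\<le>4. c2 j * (\<integral>n. (real n - 1) ^ j \<partial>poisson_pmf 1))"
    unfolding S by (rule expand[where q = "\<lambda>u. (a * u^2 + b * u - a)^2"])
      (simp add: c2_def eval_nat_numeral algebra_simps)
  then show "(\<integral>n. S n ^ 2 \<partial>poisson_pmf 1) = 1 + 2 * a ^ 2"
    using moments by (simp add: c2_def b_def eval_nat_numeral algebra_simps)
  have "(\<integral>n. S n ^ 3 \<partial>poisson_pmf 1) =
      (\<Sum>j\<le>6. c3 j * (\<integral>n. (real n - 1) ^ j \<partial>poisson_pmf 1))"
    unfolding S by (rule expand[where q = "\<lambda>u. (a * u^2 + b * u - a)^3"])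
      (simp add: c3_def eval_nat_numeral algebra_simps)
  then show "(\<integral>n. S n ^ 3 \<partial>poisson_pmf 1) = 1 + 6 * a + 12 * a ^ 2 + 12 * a ^ 3"
    using moments by (simp add: c3_def b_def eval_nat_numeral algebra_simps)
  have "(\<integral>n. S n ^ 4 \<partial>poisson_pmf 1) =
      (\<Sum>j\<le>8. c4 j * (\<integral>n. (real n - 1) ^ j \<partial>poisson_pmf 1))"
    unfolding S by (rule expand[where q = "\<lambda>u. (a * u^2 + b * u - a)^4"])
      (simp add: c4_def eval_nat_numeral algebra_simps)
  then show "(\<integral>n. S n ^ 4 \<partial>poisson_pmf 1) =
      4 + 24 * a + 108 * a ^ 2 + 224 * a ^ 3 + 212 * a ^ 4"
    using moments by (simp add: c4_def b_def eval_nat_numeral algebra_simps)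
qed

section \<open>Multiple integrals of tensor powers of an indicator\<close>

lemma tensor_power_Suc: "tensor_power (Suc m) g (x(m := y)) = tensor_power m g x * g y"
  by (simp add: tensor_power_def)

text \<open>The falling factorial counts k-tuples of distinct points of \<nu> in A. The scalar
  \<open>c\<close> is generalised so that the induction hypothesis can absorb the factor \<nu>(A) -
  k produced by one recursion step.\<close>

lemma factorial_integral_tensor_power_indicator:
  assumes "A \<in> sets \<nu>"
  shows "factorial_integral \<nu> k (\<lambda>x. c * tensor_power k (indicator A) x) =
           c * (\<Prod>j<k. measure \<nu> A - real j)"
proof (induction k arbitrary: c)
  case 0
  then show ?case
    by (simp add: tensor_power_def)
next
  case (Suc k)
  have "(\<integral>y. c * tensor_power (Suc k) (indicator A) (x(k := y)) \<partial>\<nu>) -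
        (\<Sum>j<k. c * tensor_power (Suc k) (indicator A) (x(k := x j))) =
      c * (measure \<nu> A - real k) * tensor_power k (indicator A) x" for x
  proof -
    \<comment> \<open>Indicators are idempotent, so each of the k diagonal terms reproduces the
      kernel in k variables.\<close>
    have "tensor_power k (indicator A) x * indicator A (x j) = tensor_power k (indicator A) x"
      if "j < k" for j
      using that by (auto simp: tensor_power_def indicator_def)
    then have "(\<Sum>j<k. c * tensor_power (Suc k) (indicator A) (x(k := x j))) =
        (\<Sum>j<k. c * tensor_power k (indicator A) x)"
      unfolding tensor_power_Suc by (intro sum.cong) auto
    then have "(\<Sum>j<k. c * tensor_power (Suc k) (indicator A) (x(k := x j))) =
        real k * (c * tensor_power k (indicator A) x)"
      by simp
    \<comment> \<open>If \<nu>(A) is infinite, the integral of the indicator and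
      \<open>measure \<nu> A\<close> both default to 0, so the equation persists.\<close>
    moreover have "(\<integral>y. c * tensor_power (Suc k) (indicator A) (x(k := y)) \<partial>\<nu>) =
        c * tensor_power k (indicator A) x * measure \<nu> A"
      using assms sets.sets_into_space[OF assms]
      by (simp add: tensor_power_Suc Int_absorb2 flip: mult.assoc)
    ultimately show ?thesis
      by (simp add: algebra_simps)
  qed
  then have "factorial_integral \<nu> (Suc k) (\<lambda>x. c * tensor_power (Suc k) (indicator A) x) =
      factorial_integral \<nu> k
        (\<lambda>x. c * (measure \<nu> A - real k) * tensor_power k (indicator A) x)"
    unfolding factorial_integral.simps by (simp only:)
  then show ?case
    unfolding Suc.IH by (simp add: mult_ac)
qed

text \<open>Integrating out the last m - k variables gives \<mu>(A)^(m - k), where \<mu> is the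
  locale's measure \<open>M\<close>; the other k variables give a falling factorial. The sum is the
  monic Charlier polynomial of degree m in \<nu>(A).\<close>

lemma (in sigma_finite_measure) compensated_integral_tensor_power_indicator:
  assumes "A \<in> sets M" "emeasure M A < \<infinity>" "A \<in> sets \<nu>"
  shows "compensated_integral M \<nu> m (tensor_power m (indicator A)) =
           (\<Sum>k\<le>m. (-1) ^ (m - k) * real (m choose k) * measure M A ^ (m - k) *
              (\<Prod>j<k. measure \<nu> A - real j))"
proof -
  interpret product_sigma_finite "\<lambda>_. M"
    by standard
  have A: "integrable M (indicator A :: _ \<Rightarrow> real)" "(\<integral>y. indicator A y \<partial>M) = measure M A"
    using assms sets.sets_into_space[OF assms(1)] by (auto simp: Int_absorb2)
  have "(\<integral>y. tensor_power m (indicator A) (merge {..<k} {k..<m} (x, y)) \<partial>Pi\<^sub>M {k..<m} (\<lambda>_. M)) =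
      measure M A ^ (m - k) * tensor_power k (indicator A) x" if "k \<le> m" for k x
  proof -
    have split: "{..<m} = {..<k} \<union> {k..<m}"
      using that by auto
    have "tensor_power m (indicator A) (merge {..<k} {k..<m} (x, y)) =
        tensor_power k (indicator A) x * (\<Prod>i\<in>{k..<m}. indicator A (y i))" for y
      unfolding tensor_power_def split
      by (subst prod.union_disjoint) (auto simp: merge_def intro!: prod.cong arg_cong2[where f = "(*)"])
    then show ?thesis
      using A product_integral_prod[of "{k..<m}" "\<lambda>_. indicator A :: _ \<Rightarrow> real"]
      by (simp del: integral_indicator)
  qed
  then show ?thesis
    unfolding compensated_integral_def
    using factorial_integral_tensor_power_indicator[OF assms(3)]
    by (intro sum.cong) (auto simp: mult.assoc)
qed

text \<open>This selects the pathwise branch of \<open>wiener_ito\<close>, so no L^2-limit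
  enters.\<close>

lemma (in sigma_finite_measure) integrable_tensor_power_indicator:
  assumes "A \<in> sets M" "emeasure M A < \<infinity>"
  shows "integrable (Pi\<^sub>M {..<m} (\<lambda>_. M)) (tensor_power m (indicator A))"
proof -
  interpret product_sigma_finite "\<lambda>_. M"
    by standard
  show ?thesis
    using assms unfolding tensor_power_def
    by (intro product_integrable_prod) auto
qed

text \<open>Each of the last two premises refutes one case of \<open>gaussian\<close>: a Lebesgue
  density charges no point, and a constant c' has fourth moment (c'^2)^2.\<close>

lemma not_gaussianI_atom:
  assumes "prob_space M" "X \<in> borel_measurable M" "\<not> (AE \<omega> in M. X \<omega> \<noteq> c)"
    and "(\<integral>\<omega>. X \<omega> ^ 4 \<partial>M) \<noteq> (\<integral>\<omega>. X \<omega> ^ 2 \<partial>M)\<^sup>2"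
  shows "\<not> gaussian M X"
proof
  interpret prob_space M by fact
  assume "gaussian M X"
  then consider c' \<sigma> where "distributed M lborel X (\<lambda>x. ennreal (normal_density c' \<sigma> x))"
    | c' where "AE \<omega> in M. X \<omega> = c'"
    unfolding gaussian_def by auto
  then show False
  proof cases
    case 1
    have "AE \<omega> in M. X \<omega> \<noteq> c"
      using AE_lborel_singleton[of c] by (subst distributed_AE2[OF 1]) auto
    with assms(3) show False ..
  next
    case 2
    have const: "(\<integral>\<omega>. X \<omega> ^ k \<partial>M) = c' ^ k" for k
    proof -
      have "(\<integral>\<omega>. X \<omega> ^ k \<partial>M) = (\<integral>\<omega>. c' ^ k \<partial>M)"
        using 2 assms(2) by (intro integral_cong_AE) auto
      then show ?thesis
        by (simp add: prob_space)
    qed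
    show False
      using assms(4) by (simp add: const flip: power_mult)
  qed
qed

theorem proposition3p2:
  fixes M :: "'w measure" and \<mu> :: "'e measure" and \<eta> :: "'w \<Rightarrow> 'e measure"
    and A :: "'e set" and N U V :: "'w \<Rightarrow> real" and S :: "real \<Rightarrow> 'w \<Rightarrow> real"
  assumes "poisson_random_measure M \<mu> \<eta>"
    and "A \<in> sets \<mu>" and "emeasure \<mu> A = 1"
  defines "N \<equiv> \<lambda>\<omega>. measure (\<eta> \<omega>) A"
    and "U \<equiv> wiener_ito M \<mu> \<eta> 1 (tensor_power 1 (indicator A))"
    and "V \<equiv> wiener_ito M \<mu> \<eta> 2 (tensor_power 2 (indicator A))"
    and "S \<equiv> \<lambda>\<alpha> \<omega>. 1 / sqrt (1 + 2 * \<alpha>\<^sup>2) * (U \<omega> + \<alpha> * V \<omega>)"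
  shows "distr M borel N = distr (measure_pmf (poisson_pmf 1)) borel real \<and>
    (AE \<omega> in M. U \<omega> = N \<omega> - 1) \<and>
    (AE \<omega> in M. V \<omega> = (N \<omega> - 1)\<^sup>2 - N \<omega>) \<and>
    (\<exists>\<alpha>::real.
       (\<integral>\<omega>. (S \<alpha> \<omega>)\<^sup>2 \<partial>M) = 1 \<and>
       (\<integral>\<omega>. (S \<alpha> \<omega>) ^ 4 \<partial>M) = 3 \<and>
       \<not> gaussian M (S \<alpha>) \<and>
       (\<integral>\<omega>. (S \<alpha> \<omega>) ^ 3 \<partial>M) \<noteq> 0)"
proof -
  interpret poisson_random_measure M \<mu> \<eta> by fact
  have A: "A \<in> sets \<mu>" "emeasure \<mu> A < \<infinity>" "measure \<mu> A = 1"
    using assms(2,3) by (auto simp: measure_def)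
  have A': "A \<in> sets (\<eta> \<omega>)" if "\<omega> \<in> space M" for \<omega>
    using that assms(2) by (simp add: sets_eta)
  note tensor = control.integrable_tensor_power_indicator[OF A(1,2)]
  note comp = control.compensated_integral_tensor_power_indicator[OF A(1,2) A']
  \<comment> \<open>The Charlier sums for \<mu>(A) = 1 are N - 1 and N(N - 1) - 2N + 1; these
    identities hold at every \<omega>, not only almost surely.\<close>
  have U: "U \<omega> = N \<omega> - 1" if "\<omega> \<in> space M" for \<omega>
    using that by (simp add: U_def N_def wiener_ito_def tensor comp A)
  have V: "V \<omega> = (N \<omega> - 1)\<^sup>2 - N \<omega>" if "\<omega> \<in> space M" for \<omega>
    using that
    by (simp add: V_def N_def wiener_ito_def tensor comp A eval_nat_numeral algebra_simps)
  \<comment> \<open>As a Borel function of N, S has moments determined by the law of N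
    alone.\<close>
  define s where "s = (\<lambda>\<alpha> x::real. 1 / sqrt (1 + 2 * \<alpha>\<^sup>2) * ((x - 1) + \<alpha> * ((x - 1)\<^sup>2 - x)))"
  have S: "S \<alpha> \<omega> = s \<alpha> (N \<omega>)" if "\<omega> \<in> space M" for \<alpha> \<omega>
    using that by (simp add: S_def s_def U V)
  have N_meas [measurable]: "N \<in> borel_measurable M"
    unfolding N_def measure_def using measurable_eta[OF A(1)] by measurable
  have s_meas [measurable]: "s \<alpha> \<in> borel_measurable borel" for \<alpha>
    unfolding s_def by measurable
  have S_meas: "S \<alpha> \<in> borel_measurable M" for \<alpha>
    by (subst measurable_cong[OF S]) measurable

  have law: "distr M borel N = distr (measure_pmf (poisson_pmf 1)) borel real"
  proof -
    have meas: "(\<lambda>\<omega>. emeasure (\<eta> \<omega>) A) \<in> borel_measurable M"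
      by (rule measurable_eta[OF A(1)])
    have "distr M borel N = distr (distr M borel (\<lambda>\<omega>. emeasure (\<eta> \<omega>) A)) borel enn2real"
      using meas by (simp add: distr_distr N_def measure_def comp_def)
    also have "\<dots> = distr (distr (poisson_pmf 1) borel (of_nat :: nat \<Rightarrow> ennreal)) borel enn2real"
      using law_pos[OF A(1)] A(3) assms(3) by simp
    also have "\<dots> = distr (poisson_pmf 1) borel real"
      by (simp add: distr_distr comp_def ennreal_of_nat_eq_real_of_nat)
    finally show ?thesis .
  qed
  have expectation_N: "(\<integral>\<omega>. h (N \<omega>) \<partial>M) = (\<integral>n. h (real n) \<partial>poisson_pmf 1)"
    if [measurable]: "h \<in> borel_measurable borel" for h :: "real \<Rightarrow> real"
    using arg_cong[OF law, of "\<lambda>D. \<integral>x. h x \<partial>D"] by (simp add: integral_distr)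
  have moment: "(\<integral>\<omega>. S \<alpha> \<omega> ^ k \<partial>M) =
      (\<integral>n. ((real n - 1) + \<alpha> * ((real n - 1)\<^sup>2 - real n)) ^ k \<partial>poisson_pmf 1) /
        sqrt (1 + 2 * \<alpha>\<^sup>2) ^ k" for \<alpha> k
  proof -
    have "(\<integral>\<omega>. S \<alpha> \<omega> ^ k \<partial>M) = (\<integral>\<omega>. s \<alpha> (N \<omega>) ^ k \<partial>M)"
      by (intro Bochner_Integration.integral_cong) (auto simp: S)
    also have "\<dots> = (\<integral>n. s \<alpha> (real n) ^ k \<partial>poisson_pmf 1)"
      by (rule expectation_N) measurable
    finally show ?thesis
      by (simp add: s_def power_divide)
  qed

  \<comment> \<open>The quartic is the fourth moment of U + \<alpha> V minus 3 (1 + 2 \<alpha>^2)^2.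
    It equals -0.644 at -1/10 and 1 at 0.\<close>
  have "\<exists>\<alpha>\<ge>-1/10. \<alpha> \<le> 0 \<and> 200 * \<alpha>^4 + 224 * \<alpha>^3 + 96 * \<alpha>^2 + 24 * \<alpha> + 1 = (0::real)"
    by (rule IVT') (auto intro!: continuous_intros simp: eval_nat_numeral)
  then obtain \<alpha> :: real where \<alpha>: "-1/10 \<le> \<alpha>" "\<alpha> \<le> 0"
    and root: "200 * \<alpha>^4 + 224 * \<alpha>^3 + 96 * \<alpha>^2 + 24 * \<alpha> + 1 = 0"
    by blast
  have pos: "0 < 1 + 2 * \<alpha>\<^sup>2"
    by (simp add: add_pos_nonneg)
  have sqrt4: "sqrt (1 + 2 * \<alpha>\<^sup>2) ^ 4 = (1 + 2 * \<alpha>\<^sup>2)\<^sup>2"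
    using pos power_mult[of "sqrt (1 + 2 * \<alpha>\<^sup>2)" 2 2] by simp
  have S2: "(\<integral>\<omega>. (S \<alpha> \<omega>)\<^sup>2 \<partial>M) = 1"
    using pos by (simp add: moment poisson_pmf_1_chaos_moments)
  have S4: "(\<integral>\<omega>. (S \<alpha> \<omega>) ^ 4 \<partial>M) = 3"
  proof -
    have "4 + 24 * \<alpha> + 108 * \<alpha>^2 + 224 * \<alpha>^3 + 212 * \<alpha>^4 = 3 * (1 + 2 * \<alpha>\<^sup>2)\<^sup>2"
      using root by (simp add: power2_sum power_mult_distrib flip: power_mult)
    then show ?thesis
      using pos by (simp add: moment poisson_pmf_1_chaos_moments sqrt4)
  qed
  have S3: "(\<integral>\<omega>. (S \<alpha> \<omega>) ^ 3 \<partial>M) \<noteq> 0"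
  proof -
    \<comment> \<open>The bound \<alpha> \<ge> -1/10 also gives 1 + 6 \<alpha> \<ge> 2/5, and the
      two remaining terms add up to this nonnegative product.\<close>
    have "0 \<le> 12 * \<alpha>^2 * (1 + \<alpha>)"
      using \<alpha> by (intro mult_nonneg_nonneg) auto
    then have "0 < 1 + 6 * \<alpha> + 12 * \<alpha>^2 + 12 * \<alpha>^3"
      using \<alpha> by (simp add: algebra_simps eval_nat_numeral)
    then show ?thesis
      using pos by (simp add: moment poisson_pmf_1_chaos_moments)
  qed
  \<comment> \<open>The event N = 0 forces S = \<open>s \<alpha> 0\<close> and has positive Poisson
    probability.\<close>
  have "\<not> (AE \<omega> in M. S \<alpha> \<omega> \<noteq> s \<alpha> 0)"
  proof
    assume "AE \<omega> in M. S \<alpha> \<omega> \<noteq> s \<alpha> 0"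
    then have "AE \<omega> in M. N \<omega> \<noteq> 0"
      using AE_space by eventually_elim (auto simp: S)
    then have "AE x in distr M borel N. x \<noteq> 0"
      by (subst AE_distr_iff) auto
    then have "AE n in poisson_pmf 1. real n \<noteq> 0"
      unfolding law by (subst (asm) AE_distr_iff) auto
    then show False
      by (auto simp: AE_measure_pmf_iff)
  qed
  then have "\<not> gaussian M (S \<alpha>)"
    using S_meas S2 S4 by (intro not_gaussianI_atom[OF prob_space_axioms]) auto
  with S2 S3 S4 law show ?thesis
    using U V by blast
qed

end
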